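(* Let $n \geq 2$ be an integer. For every $t \in [0,1]$, let $\mathscr{L}_t$ be the set of lines in $\mathbb{R}^n$ which are at distance $t$ from the origin. Then $$\max_{\ell \in \mathscr{L}_t} |B_1^n \cap \ell| = \begin{cases} \dfrac{2}{t+\sqrt{1-t^2}}, & t \in \left[0,\frac{1}{\sqrt{2}}\right], \\[2mm] t- \sqrt{t^2-\frac{1}{2}}, & t \in \left(\frac{1}{\sqrt{2}},\frac{3}{4}\right], \\[2mm] 2 - 2t, & t \in \left(\frac{3}{4},1\right]. \end{cases}$$ Moreover, the maximum is attained by some line $\ell \in \mathscr{L}_t$ contained in a $2$-dimensional coordinate subspace, that is, a subspace spanned by $e_i$ and $e_j$ for some $i \neq j$.
   Context: $B_1^n = \{x \in \mathbb{R}^n : \sum_{i=1}^n |x_i| \leq 1\} = \mathrm{conv}\{\pm e_1,\dots,\pm e_n\}$ is the cross-polytope, where $e_1,\dots,e_n$ is the standard basis of $\mathbb{R}^n$. Lines are affine lines (not necessarily through the origin), distances are Euclidean, and $|B_1^n\cap \ell|$ denotes the length (1-dimensional Lebesgue measure on $\ell$) of $B_1^n \cap \ell$, equal to $0$ if the intersection is empty. *)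

theory Defs
  imports "HOL-Analysis.Analysis"
begin

definition cross_polytope :: "(real ^ 'n) set" where
  "cross_polytope = {x. (\<Sum>i\<in>UNIV. \<bar>x $ i\<bar>) \<le> 1}"

definition is_line :: "'a::euclidean_space set \<Rightarrow> bool" where
  "is_line L \<longleftrightarrow> affine L \<and> aff_dim L = 1"

definition lines_at_distance :: "real \<Rightarrow> 'a::euclidean_space set set" where
  "lines_at_distance t = {L. is_line L \<and> infdist 0 L = t}"

text \<open>
  \<open>length_on L A\<close> is the one-dimensional Lebesgue measure of \<open>A \<inter> L\<close> on the line \<open>L\<close>,
  transported from the real line by a unit-speed parametrization of \<open>L\<close>. Lemma
  \<open>length_on_eq\<close> below shows that the value does not depend on the parametrization,
  and \<open>is_line_parametrization\<close> that every line has one. As usual for \<^const>\<open>measure\<close>,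
  the value is a real number, so it is only meaningful if \<open>A \<inter> L\<close> has finite length.
\<close>

definition length_on :: "'a::euclidean_space set \<Rightarrow> 'a set \<Rightarrow> real" where
  "length_on L A = (THE r. \<exists>p u. norm u = 1 \<and> L = range (\<lambda>s. p + s *\<^sub>R u) \<and>
     r = measure lebesgue {s. p + s *\<^sub>R u \<in> A \<inter> L})"

definition max_chord_length :: "real \<Rightarrow> real" where
  "max_chord_length t =
     (if t \<le> 1 / sqrt 2 then 2 / (t + sqrt (1 - t\<^sup>2))
      else if t \<le> 3 / 4 then t - sqrt (t\<^sup>2 - 1 / 2)
      else 2 - 2 * t)"

lemma is_line_parametrization:
  fixes L :: "'a::euclidean_space set"
  shows "is_line L \<longleftrightarrow> (\<exists>p u. norm u = 1 \<and> L = range (\<lambda>s. p + s *\<^sub>R u))"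
proof
  assume L: "is_line L"
  then have "affine L" "aff_dim L = 1" by (auto simp: is_line_def)
  then obtain p where p: "p \<in> L" by fastforce
  let ?V = "(\<lambda>x. x - p) ` L"
  have V: "subspace ?V"
    using affine_diffs_subspace_subtract[OF \<open>affine L\<close> p] .
  have "aff_dim ?V = 1"
    using aff_dim_translation_eq_subtract[of p L] \<open>aff_dim L = 1\<close> by simp
  then have dV: "dim ?V = 1"
    using aff_dim_subspace[OF V] by simp
  have "?V \<noteq> {0}"
    using dV by (metis dim_eq_0 subset_refl zero_neq_one)
  moreover have "0 \<in> ?V" using V by (rule subspace_0)
  ultimately obtain w where w: "w \<in> ?V" "w \<noteq> 0" by blast
  have "?V = span {w}"
  proof -
    have "span {w} \<subseteq> ?V"
      using V w by (intro span_minimal) auto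
    moreover have "dim ?V \<le> dim (span {w})"
      unfolding dV using w by (simp add: dim_insert)
    ultimately show ?thesis
      using subspace_dim_equal[OF subspace_span V, of "{w}"] by blast
  qed
  also have "span {w} = range (\<lambda>s. s *\<^sub>R (w /\<^sub>R norm w))"
  proof -
    have "s *\<^sub>R w = (s * norm w) *\<^sub>R (w /\<^sub>R norm w)" for s using w by simp
    moreover have "s *\<^sub>R (w /\<^sub>R norm w) = (s / norm w) *\<^sub>R w" for s
      by (simp add: divide_inverse)
    ultimately show ?thesis
      unfolding span_singleton by blast
  qed
  finally have V2: "?V = range (\<lambda>s. s *\<^sub>R (w /\<^sub>R norm w))" .
  have "L = (\<lambda>x. p + x) ` ?V" by (auto simp: image_image)
  also have "\<dots> = range (\<lambda>s. p + s *\<^sub>R (w /\<^sub>R norm w))"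
    unfolding V2 by (simp add: image_image)
  finally have "L = range (\<lambda>s. p + s *\<^sub>R (w /\<^sub>R norm w))" .
  moreover have "norm (w /\<^sub>R norm w) = 1" using w by simp
  ultimately show "\<exists>p u. norm u = 1 \<and> L = range (\<lambda>s. p + s *\<^sub>R u)" by blast
next
  assume "\<exists>p u. norm u = 1 \<and> L = range (\<lambda>s. p + s *\<^sub>R u)"
  then obtain p u where u: "norm u = 1" and L: "L = range (\<lambda>s. p + s *\<^sub>R u)" by blast
  have L2: "L = (\<lambda>x. p + x) ` span {u}"
    unfolding L span_singleton by (simp add: image_image)
  have "u \<noteq> 0" using u by auto
  then have "aff_dim (span {u}) = 1"
    by (simp add: aff_dim_subspace dim_insert)
  moreover have "affine L"
    unfolding L2 using affine_translation[of "span {u}" p]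
    by (simp add: subspace_imp_affine)
  ultimately show "is_line L"
    unfolding is_line_def L2 by (simp add: aff_dim_translation_eq)
qed

lemma length_on_eq:
  fixes p u :: "'a::euclidean_space"
  assumes u: "norm u = 1" and L: "L = range (\<lambda>s. p + s *\<^sub>R u)"
  shows "length_on L A = measure lebesgue {s. p + s *\<^sub>R u \<in> A}"
proof -
  have eq: "measure lebesgue {s. q + s *\<^sub>R v \<in> A \<inter> L} = measure lebesgue {s. p + s *\<^sub>R u \<in> A}"
    if v: "norm v = 1" and Lv: "L = range (\<lambda>s. q + s *\<^sub>R v)" for q v
  proof -
    have "q + 0 *\<^sub>R v \<in> L" unfolding Lv by blast
    then obtain a where a: "q = p + a *\<^sub>R u" unfolding L by auto
    have "q + 1 *\<^sub>R v \<in> L" unfolding Lv by blast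
    then obtain b where b: "q + v = p + b *\<^sub>R u" unfolding L by auto
    have vu: "v = (b - a) *\<^sub>R u" using a b by (simp add: algebra_simps)
    define c where "c = b - a"
    have c: "\<bar>c\<bar> = 1" using v u vu by (simp add: c_def)
    let ?T = "{s. p + s *\<^sub>R u \<in> A}"
    have "{s. q + s *\<^sub>R v \<in> A \<inter> L} = {s. q + s *\<^sub>R v \<in> A}"
      using Lv by auto
    also have "\<dots> = {s. a + c * s \<in> ?T}"
      by (simp add: a vu c_def algebra_simps)
    also have "\<dots> = (\<lambda>x. (- c * a) + c * x) ` ?T"
    proof -
      have cc: "c * c = 1" using c by (metis abs_mult_self_eq mult_1)
      have 1: "a + c * (- c * a + c * x) = x" for x
      proof -
        have "a + c * (- c * a + c * x) = a - (c * c) * a + (c * c) * x"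
          by (simp add: algebra_simps)
        then show ?thesis by (simp add: cc)
      qed
      have 2: "- c * a + c * (a + c * x) = x" for x
      proof -
        have "- c * a + c * (a + c * x) = (c * c) * x"
          by (simp add: algebra_simps)
        then show ?thesis by (simp add: cc)
      qed
      show ?thesis
      proof (intro set_eqI iffI)
        fix x assume "x \<in> {s. a + c * s \<in> ?T}"
        then show "x \<in> (\<lambda>x. (- c * a) + c * x) ` ?T"
          by (intro image_eqI[of x _ "a + c * x"]) (simp_all only: 2 mem_Collect_eq)
      next
        fix x assume "x \<in> (\<lambda>x. (- c * a) + c * x) ` ?T"
        then obtain y where "y \<in> ?T" "x = - c * a + c * y" by blast
        then show "x \<in> {s. a + c * s \<in> ?T}" by (simp only: 1 mem_Collect_eq)
      qed
    qed
    also have "\<dots> = (\<lambda>x. c *\<^sub>R x + (- c * a)) ` ?T"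
      by (intro image_cong refl) (simp only: real_scaleR_def add.commute)
    finally have S: "{s. q + s *\<^sub>R v \<in> A \<inter> L} = (\<lambda>x. c *\<^sub>R x + (- c * a)) ` ?T" .
    have "measure lebesgue ((\<lambda>x. c *\<^sub>R x + (- c * a)) ` ?T) = \<bar>c\<bar> ^ DIM(real) * measure lebesgue ?T"
      by (rule measure_lebesgue_affine)
    then show ?thesis
      unfolding S c by simp
  qed
  show ?thesis
    unfolding length_on_def
  proof (rule the_equality)
    have "measure lebesgue {s. p + s *\<^sub>R u \<in> A} = measure lebesgue {s. p + s *\<^sub>R u \<in> A \<inter> L}"
      using eq[OF u L] by simp
    then show "\<exists>q v. norm v = 1 \<and> L = range (\<lambda>s. q + s *\<^sub>R v) \<and>
        measure lebesgue {s. p + s *\<^sub>R u \<in> A} = measure lebesgue {s. q + s *\<^sub>R v \<in> A \<inter> L}"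
      using u L by (intro exI[of _ p] exI[of _ u] conjI)
  next
    fix r
    assume "\<exists>q v. norm v = 1 \<and> L = range (\<lambda>s. q + s *\<^sub>R v) \<and>
        r = measure lebesgue {s. q + s *\<^sub>R v \<in> A \<inter> L}"
    then show "r = measure lebesgue {s. p + s *\<^sub>R u \<in> A}"
      using eq by metis
  qed
qed

end

theory Submission
  imports Defs
begin

text \<open>
  Let \<open>x\<close>, \<open>y\<close> be the endpoints of the chord cut out by a line at distance at least \<open>t\<close> from
  the origin. Writing \<open>X\<close>, \<open>Y\<close>, \<open>q\<close> for the inner products \<open>x \<bullet> x\<close>, \<open>y \<bullet> y\<close>, \<open>x \<bullet> y\<close>, the length \<open>N\<close>
  of the chord satisfies \<open>N\<^sup>2 = X + Y - 2 * q\<close>, and the distance condition becomes the Gram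
  determinant inequality \<open>t\<^sup>2 * N\<^sup>2 \<le> X * Y - q\<^sup>2\<close>. For fixed \<open>q\<close>, raising \<open>X\<close> or \<open>Y\<close> lengthens
  the chord and keeps the inequality, because its slack has derivative \<open>Y - t\<^sup>2 \<ge> 0\<close> in \<open>X\<close>, and
  symmetrically in \<open>Y\<close>. Hence, for any coordinate \<open>i\<close>, one may pretend that \<open>x\<close> has only one
  nonzero coordinate besides the \<open>i\<close>-th, namely one of size \<open>\<alpha> = 1 - \<bar>x\<^sub>i\<bar>\<close>, and \<open>y\<close> one of
  size \<open>\<beta> = 1 - \<bar>y\<^sub>i\<bar>\<close>; the inner product \<open>r\<close> of these two remainders lies between \<open>-\<alpha> * \<beta>\<close> and
  \<open>\<alpha> * \<beta>\<close> (\<open>gram_relaxation\<close>). This replaces dimension \<open>n\<close> by a polynomial problem in the three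
  numbers \<open>\<alpha>\<close>, \<open>\<beta>\<close>, \<open>r\<close>. What remains is to choose \<open>i\<close> well.

  If \<open>t \<le> 1 / sqrt 2\<close>, put \<open>c = sqrt (1 - t\<^sup>2)\<close>, so \<open>t \<le> c\<close>. The \<open>l\<^sup>1\<close> norm of \<open>x - y\<close> is at most \<open>2\<close>, so a chord
  of length \<open>N > 2 / (t + c)\<close> must be nearly parallel to some axis: \<open>\<bar>x\<^sub>i - y\<^sub>i\<bar> > c * N\<close>
  (\<open>exists_long_coordinate\<close>). Then \<open>x\<^sub>i\<close>, \<open>y\<^sub>i\<close> have opposite signs and \<open>\<alpha> + \<beta>\<close> is too small
  for the line to keep distance \<open>t\<close> (\<open>opposite_facets_infeasible\<close>).

  If \<open>t > 1 / sqrt 2\<close>, every point of the chord has squared norm above \<open>1 / 2\<close>, hence a coordinate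
  of absolute value above \<open>1 / 2\<close>. By the intermediate value property this coordinate and its sign
  are the same for \<open>x\<close> and \<open>y\<close> (\<open>dominant_coordinate_constant\<close>): the line cuts off a corner. With
  this \<open>i\<close> the polynomial problem yields both remaining cases of the formula (\<open>corner_bound\<close>).

  Equality is attained in a coordinate plane (\<open>planar_chord_max_length\<close>): by a line through the
  vertex \<open>e\<^sub>i\<close> in the first case, by a line cutting the two edges at \<open>e\<^sub>i\<close> at distances from
  \<open>e\<^sub>i\<close> that add up to half the edge length in the second one, and by a line orthogonal to \<open>e\<^sub>i\<close> in the third one.
\<close>

section \<open>Coordinates and convexity of the cross-polytope\<close>

lemma sum_power2_le_power2_sum:
  fixes f :: "'a \<Rightarrow> real"
  assumes "finite A" "\<And>k. k \<in> A \<Longrightarrow> 0 \<le> f k"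
  shows "(\<Sum>k\<in>A. (f k)\<^sup>2) \<le> (\<Sum>k\<in>A. f k)\<^sup>2"
proof -
  have "(\<Sum>k\<in>A. f k * f k) \<le> (\<Sum>k\<in>A. f k * (\<Sum>k\<in>A. f k))"
    using assms by (intro sum_mono mult_left_mono member_le_sum) auto
  then show ?thesis by (simp add: power2_eq_square sum_distrib_right)
qed

lemma abs_sum_mult_le:
  fixes f g :: "'a \<Rightarrow> real"
  assumes "finite A"
  shows "\<bar>\<Sum>k\<in>A. f k * g k\<bar> \<le> (\<Sum>k\<in>A. \<bar>f k\<bar>) * (\<Sum>k\<in>A. \<bar>g k\<bar>)"
proof -
  have "\<bar>\<Sum>k\<in>A. f k * g k\<bar> \<le> (\<Sum>k\<in>A. \<bar>f k\<bar> * \<bar>g k\<bar>)"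
    by (metis (no_types, lifting) abs_mult sum_abs sum.cong)
  also have "\<dots> \<le> (\<Sum>k\<in>A. \<bar>f k\<bar> * (\<Sum>k\<in>A. \<bar>g k\<bar>))"
    using assms by (intro sum_mono mult_left_mono member_le_sum) auto
  finally show ?thesis by (simp add: sum_distrib_right)
qed

lemma inner_split_coordinate:
  fixes x y :: "real ^ 'n"
  shows "x \<bullet> y = x $ i * y $ i + (\<Sum>k\<in>UNIV - {i}. x $ k * y $ k)"
  by (simp add: inner_vec_def sum.remove[of UNIV i])

lemma cross_polytope_split_coordinate:
  fixes x :: "real ^ 'n"
  assumes "x \<in> cross_polytope"
  shows "(\<Sum>k\<in>UNIV - {i}. \<bar>x $ k\<bar>) \<le> 1 - \<bar>x $ i\<bar>"
  using assms by (simp add: cross_polytope_def sum.remove[of UNIV i])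

text \<open>
  All but the \<open>i\<close>-th coordinate contribute most to the Euclidean norm when they are concentrated
  in a single one.
\<close>

lemma norm_le_in_cross_polytope:
  fixes x :: "real ^ 'n"
  assumes "x \<in> cross_polytope"
  shows "(norm x)\<^sup>2 \<le> (x $ i)\<^sup>2 + (1 - \<bar>x $ i\<bar>)\<^sup>2"
proof -
  have "(\<Sum>k\<in>UNIV - {i}. \<bar>x $ k\<bar>\<^sup>2) \<le> (\<Sum>k\<in>UNIV - {i}. \<bar>x $ k\<bar>)\<^sup>2"
    by (intro sum_power2_le_power2_sum) auto
  also have "\<dots> \<le> (1 - \<bar>x $ i\<bar>)\<^sup>2"
    using cross_polytope_split_coordinate[OF assms] by (intro power_mono sum_nonneg) auto
  finally show ?thesis
    unfolding power2_norm_eq_inner inner_split_coordinate[of x x i]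
    by (simp add: power2_eq_square)
qed

lemma exists_coordinate_gt_half:
  fixes x :: "real ^ 'n"
  assumes "x \<in> cross_polytope" "1 / 2 < (norm x)\<^sup>2"
  shows "\<exists>i. 1 / 2 < \<bar>x $ i\<bar>"
proof (rule ccontr)
  assume "\<not> ?thesis"
  then have *: "\<bar>x $ i\<bar> \<le> 1 / 2" for i by (meson not_le)
  have "(norm x)\<^sup>2 = (\<Sum>i\<in>UNIV. \<bar>x $ i\<bar> * \<bar>x $ i\<bar>)"
    by (simp add: power2_norm_eq_inner inner_vec_def)
  also have "\<dots> \<le> (\<Sum>i\<in>UNIV. 1 / 2 * \<bar>x $ i\<bar>)"
    by (intro sum_mono mult_right_mono *) auto
  also have "\<dots> \<le> 1 / 2"
    unfolding sum_distrib_left[symmetric] using assms by (simp add: cross_polytope_def)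
  finally show False using assms by simp
qed

lemma convex_cross_polytope: "convex (cross_polytope :: (real ^ 'n) set)"
proof (rule convexI)
  fix x y :: "real ^ 'n" and a b :: real
  assume *: "x \<in> cross_polytope" "y \<in> cross_polytope" "0 \<le> a" "0 \<le> b" "a + b = 1"
  have "(\<Sum>i\<in>UNIV. \<bar>(a *\<^sub>R x + b *\<^sub>R y) $ i\<bar>) \<le> (\<Sum>i\<in>UNIV. a * \<bar>x $ i\<bar> + b * \<bar>y $ i\<bar>)"
    using * by (intro sum_mono) (auto intro!: order_trans[OF abs_triangle_ineq] simp: abs_mult)
  also have "\<dots> = a * (\<Sum>i\<in>UNIV. \<bar>x $ i\<bar>) + b * (\<Sum>i\<in>UNIV. \<bar>y $ i\<bar>)"
    by (simp add: sum.distrib sum_distrib_left)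
  also have "\<dots> \<le> a * 1 + b * 1"
    using * by (intro add_mono mult_left_mono) (auto simp: cross_polytope_def)
  finally show "a *\<^sub>R x + b *\<^sub>R y \<in> cross_polytope"
    using * by (simp add: cross_polytope_def)
qed

lemma closed_cross_polytope: "closed (cross_polytope :: (real ^ 'n) set)"
  unfolding cross_polytope_def by (intro closed_Collect_le continuous_intros)

lemma norm_le_1_in_cross_polytope:
  fixes x :: "real ^ 'n"
  assumes "x \<in> cross_polytope"
  shows "norm x \<le> 1"
  using norm_le_l1_cart[of x] assms by (simp add: cross_polytope_def)

section \<open>Reduction to three real parameters\<close>

text \<open>
  The Gram determinant of \<open>x\<close> and \<open>y\<close> is the squared distance of the origin from the line through
  them, times the squared length of the segment: both are four times the squared area of
  the triangle with vertices \<open>0\<close>, \<open>x\<close>, \<open>y\<close>.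
\<close>

lemma gram_ge_of_line_far:
  fixes x y :: "'a::real_inner"
  assumes far: "\<And>s. t \<le> norm (x + s *\<^sub>R (y - x))" and "0 \<le> t"
  shows "t\<^sup>2 * (norm (x - y))\<^sup>2 \<le> (norm x)\<^sup>2 * (norm y)\<^sup>2 - (x \<bullet> y)\<^sup>2"
proof (cases "x = y")
  case True
  then show ?thesis unfolding power2_norm_eq_inner by (simp add: power2_eq_square)
next
  case False
  define v where "v = y - x"
  have v: "v \<bullet> v > 0" using False by (simp add: v_def)
  \<comment> \<open>the parameter of the foot of the perpendicular from the origin\<close>
  define s where "s = - (x \<bullet> v) / (v \<bullet> v)"
  have "t\<^sup>2 \<le> (norm (x + s *\<^sub>R v))\<^sup>2"
    using far[of s] \<open>0 \<le> t\<close> unfolding v_def by (intro power_mono)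
  also have "\<dots> = x \<bullet> x + 2 * s * (x \<bullet> v) + s\<^sup>2 * (v \<bullet> v)"
    unfolding power2_norm_eq_inner by (simp add: algebra_simps inner_commute power2_eq_square)
  also have "\<dots> = x \<bullet> x - (x \<bullet> v)\<^sup>2 / (v \<bullet> v)"
    using v by (simp add: s_def field_simps power2_eq_square)
  finally have "t\<^sup>2 * (v \<bullet> v) \<le> (x \<bullet> x - (x \<bullet> v)\<^sup>2 / (v \<bullet> v)) * (v \<bullet> v)"
    using v by (intro mult_right_mono) auto
  also have "\<dots> = (x \<bullet> x) * (v \<bullet> v) - (x \<bullet> v)\<^sup>2"
    using v by (simp add: field_simps)
  also have "\<dots> = (x \<bullet> x) * (y \<bullet> y) - (x \<bullet> y)\<^sup>2"
    by (simp add: v_def algebra_simps inner_commute power2_eq_square)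
  finally show ?thesis
    by (simp add: v_def power2_norm_eq_inner norm_minus_commute[of x y])
qed

text \<open>
  The squared norms of \<open>x\<close> and \<open>y\<close> are replaced by
  the largest values compatible with their \<open>i\<close>-th coordinates, while the inner product is kept. The
  length grows, and the Gram inequality survives because its slack is affine in
  each squared norm with a nonnegative coefficient.
\<close>

lemma gram_relaxation:
  fixes x y :: "real ^ 'n" and i :: 'n
  assumes x: "x \<in> cross_polytope" and y: "y \<in> cross_polytope"
    and gram: "t\<^sup>2 * (norm (x - y))\<^sup>2 \<le> (norm x)\<^sup>2 * (norm y)\<^sup>2 - (x \<bullet> y)\<^sup>2"
    and tx: "t\<^sup>2 \<le> (norm x)\<^sup>2" and ty: "t\<^sup>2 \<le> (norm y)\<^sup>2"
    and \<alpha>: "\<alpha> = 1 - \<bar>x $ i\<bar>" and \<beta>: "\<beta> = 1 - \<bar>y $ i\<bar>"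
  obtains r where "\<bar>r\<bar> \<le> \<alpha> * \<beta>"
    and "(norm (x - y))\<^sup>2 \<le> ((1 - \<alpha>)\<^sup>2 + \<alpha>\<^sup>2) + ((1 - \<beta>)\<^sup>2 + \<beta>\<^sup>2) - 2 * (x $ i * y $ i + r)"
    and "t\<^sup>2 * (((1 - \<alpha>)\<^sup>2 + \<alpha>\<^sup>2) + ((1 - \<beta>)\<^sup>2 + \<beta>\<^sup>2) - 2 * (x $ i * y $ i + r))
      \<le> ((1 - \<alpha>)\<^sup>2 + \<alpha>\<^sup>2) * ((1 - \<beta>)\<^sup>2 + \<beta>\<^sup>2) - (x $ i * y $ i + r)\<^sup>2"
proof
  let ?r = "\<Sum>k\<in>UNIV - {i}. x $ k * y $ k"
  have xs: "(\<Sum>k\<in>UNIV - {i}. \<bar>x $ k\<bar>) \<le> \<alpha>" and ys: "(\<Sum>k\<in>UNIV - {i}. \<bar>y $ k\<bar>) \<le> \<beta>"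
    using cross_polytope_split_coordinate x y \<alpha> \<beta> by auto
  have "\<bar>?r\<bar> \<le> (\<Sum>k\<in>UNIV - {i}. \<bar>x $ k\<bar>) * (\<Sum>k\<in>UNIV - {i}. \<bar>y $ k\<bar>)"
    by (rule abs_sum_mult_le) simp
  also have "\<dots> \<le> \<alpha> * \<beta>"
    using xs ys by (intro mult_mono order_trans[OF _ xs] sum_nonneg) auto
  finally show "\<bar>?r\<bar> \<le> \<alpha> * \<beta>" .
  define X Y q where "X = (norm x)\<^sup>2" and "Y = (norm y)\<^sup>2" and "q = x $ i * y $ i + ?r"
  define X' Y' where "X' = (1 - \<alpha>)\<^sup>2 + \<alpha>\<^sup>2" and "Y' = (1 - \<beta>)\<^sup>2 + \<beta>\<^sup>2"
  have q: "x \<bullet> y = q" unfolding q_def by (rule inner_split_coordinate)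
  have le: "X \<le> X'" "Y \<le> Y'"
    using norm_le_in_cross_polytope[OF x, of i] norm_le_in_cross_polytope[OF y, of i]
    by (simp_all add: X_def Y_def X'_def Y'_def \<alpha> \<beta>)
  have N: "(norm (x - y))\<^sup>2 = X + Y - 2 * q"
    unfolding X_def Y_def q[symmetric] power2_norm_eq_inner
    by (simp add: algebra_simps inner_commute)
  show "(norm (x - y))\<^sup>2 \<le> (1 - \<alpha>)\<^sup>2 + \<alpha>\<^sup>2 + ((1 - \<beta>)\<^sup>2 + \<beta>\<^sup>2) - 2 * (x $ i * y $ i + ?r)"
    unfolding N X'_def[symmetric] Y'_def[symmetric] q_def[symmetric] using le by simp
  have "t\<^sup>2 * (X + Y - 2 * q) \<le> X * Y - q\<^sup>2"
    using gram unfolding N q X_def Y_def .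
  moreover have "0 \<le> (X' - X) * (Y - t\<^sup>2)" "0 \<le> (Y' - Y) * (X' - t\<^sup>2)"
    using le tx ty by (auto intro!: mult_nonneg_nonneg simp: X_def Y_def)
  ultimately have "t\<^sup>2 * (X' + Y' - 2 * q) \<le> X' * Y' - q\<^sup>2"
    by (simp add: algebra_simps)
  then show "t\<^sup>2 * ((1 - \<alpha>)\<^sup>2 + \<alpha>\<^sup>2 + ((1 - \<beta>)\<^sup>2 + \<beta>\<^sup>2) - 2 * (x $ i * y $ i + ?r))
    \<le> ((1 - \<alpha>)\<^sup>2 + \<alpha>\<^sup>2) * ((1 - \<beta>)\<^sup>2 + \<beta>\<^sup>2) - (x $ i * y $ i + ?r)\<^sup>2"
    unfolding X'_def Y'_def q_def .
qed

section \<open>Long chords close to the origin\<close>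

text \<open>
  Suppose that no entry exceeds \<open>c * N\<close>. If there is an entry \<open>d\<close> of at least \<open>s * N\<close>,
  the sum of the entries is at least \<open>d + sqrt (N\<^sup>2 - d\<^sup>2)\<close>, which is at least \<open>N * (s + c)\<close> by
  concavity. If all entries are below \<open>s * N\<close>, the sum is at least \<open>N / s\<close>, which is
  no smaller. Both contradict the bound \<open>2\<close> on the sum.
\<close>

lemma exists_long_coordinate:
  fixes d :: "'n::finite \<Rightarrow> real"
  assumes d: "\<And>k. 0 \<le> d k" and le2: "(\<Sum>k\<in>UNIV. d k) \<le> 2"
    and N: "(\<Sum>k\<in>UNIV. (d k)\<^sup>2) = N\<^sup>2" "0 \<le> N"
    and s: "0 \<le> s" "s \<le> c" "s\<^sup>2 + c\<^sup>2 = 1" and long: "2 < N * (s + c)"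
  shows "\<exists>k. c * N < d k"
proof (rule ccontr)
  assume "\<not> ?thesis"
  then have upper: "d k \<le> c * N" for k by (meson not_le)
  have "N > 0" using N long by (cases "N = 0") auto
  show False
  proof (cases "\<exists>k. s * N \<le> d k")
    case True
    then obtain k where k: "s * N \<le> d k" by blast
    define e where "e = (\<Sum>j\<in>UNIV - {k}. d j)"
    have "(\<Sum>j\<in>UNIV - {k}. (d j)\<^sup>2) \<le> e\<^sup>2"
      unfolding e_def using d by (intro sum_power2_le_power2_sum) auto
    then have "N\<^sup>2 - (d k)\<^sup>2 \<le> e\<^sup>2"
      using N(1) by (simp add: sum.remove[of UNIV k])
    also have "\<dots> < (N * (s + c) - d k)\<^sup>2"
    proof (rule power_strict_mono)
      show "e < N * (s + c) - d k"
        using le2 long by (simp add: e_def sum.remove[of UNIV k])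
    qed (auto simp: e_def intro: sum_nonneg d)
    finally have "0 < 2 * ((d k - s * N) * (d k - c * N)) + N\<^sup>2 * (s\<^sup>2 + c\<^sup>2 - 1)"
      by (simp add: power2_eq_square algebra_simps)
    then have "0 < (d k - s * N) * (d k - c * N)" using s(3) by (simp add: mult.commute)
    moreover have "(d k - s * N) * (d k - c * N) \<le> 0"
      using k upper[of k] by (intro mult_nonneg_nonpos) auto
    ultimately show False by linarith
  next
    case False
    have "N\<^sup>2 = (\<Sum>k\<in>UNIV. d k * d k)" using N by (simp add: power2_eq_square)
    also have "\<dots> \<le> (\<Sum>k\<in>UNIV. s * N * d k)"
      using False d by (intro sum_mono mult_right_mono) (auto simp: not_le less_imp_le)
    also have "\<dots> = s * N * (\<Sum>k\<in>UNIV. d k)" by (simp add: sum_distrib_left)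
    also have "\<dots> \<le> s * N * 2" using le2 s N by (intro mult_left_mono) auto
    finally have "N * N \<le> N * (2 * s)" by (simp add: power2_eq_square mult_ac)
    then have "N \<le> 2 * s" using \<open>N > 0\<close> by simp
    then have "N * (s + c) \<le> 2 * s * (s + c)" using s by (intro mult_right_mono) auto
    also have "\<dots> = 2 * (s\<^sup>2 + s * c)" by (simp add: power2_eq_square algebra_simps)
    also have "\<dots> \<le> 2 * (s\<^sup>2 + c * c)" using s by (intro mult_left_mono add_left_mono mult_right_mono) auto
    also have "\<dots> = 2" using s by (simp add: power2_eq_square)
    finally show False using long by simp
  qed
qed

text \<open>
  Here the \<open>i\<close>-th coordinates \<open>1 - \<alpha>\<close> and \<open>- (1 - \<beta>)\<close> have opposite signs. The chord from the vertex
  \<open>e\<^sub>i\<close> in the direction at angle \<open>arcsin s\<close> to the axis has \<open>\<alpha> = 0\<close> and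
  \<open>\<beta> = 2 * s / (s + c)\<close>; for a smaller sum \<open>\<alpha> + \<beta>\<close> the line passes too close to the origin.
  In terms of \<open>\<sigma> = \<alpha> + \<beta>\<close>, \<open>\<pi> = \<alpha> * \<beta>\<close> and \<open>\<delta> = \<alpha> * \<beta> - r\<close>, the terms with \<open>\<delta>\<close> only help, and
  what remains is concave in \<open>\<pi>\<close>, so that only \<open>\<pi> = 0\<close> and \<open>\<alpha> = \<beta>\<close> need to be looked at.
\<close>

lemma opposite_facets_infeasible:
  fixes \<alpha> \<beta> r s c :: real
  assumes "0 \<le> \<alpha>" "0 \<le> \<beta>" and r: "\<bar>r\<bar> \<le> \<alpha> * \<beta>"
    and "0 \<le> s" "s \<le> c" and sc: "s\<^sup>2 + c\<^sup>2 = 1"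
    and small: "(\<alpha> + \<beta>) * (s + c) < 2 * s"
  shows "((1 - \<alpha>)\<^sup>2 + \<alpha>\<^sup>2) * ((1 - \<beta>)\<^sup>2 + \<beta>\<^sup>2) - (- ((1 - \<alpha>) * (1 - \<beta>)) + r)\<^sup>2
    < s\<^sup>2 * (((1 - \<alpha>)\<^sup>2 + \<alpha>\<^sup>2) + ((1 - \<beta>)\<^sup>2 + \<beta>\<^sup>2) - 2 * (- ((1 - \<alpha>) * (1 - \<beta>)) + r))"
proof -
  define \<sigma> \<pi> \<delta> where "\<sigma> = \<alpha> + \<beta>" and "\<pi> = \<alpha> * \<beta>" and "\<delta> = \<alpha> * \<beta> - r"
  have nn: "0 \<le> \<sigma>" "0 \<le> \<pi>" "0 \<le> \<delta>"
    using assms by (auto simp: \<sigma>_def \<pi>_def \<delta>_def)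
  have \<pi>\<sigma>: "4 * \<pi> \<le> \<sigma>\<^sup>2"
    using zero_le_power2[of "\<alpha> - \<beta>"] by (simp add: \<sigma>_def \<pi>_def power2_eq_square algebra_simps)
  have s: "0 < s"
    using small assms nn by (smt (verit) \<sigma>_def mult_nonneg_nonneg)
  have "s * \<sigma> \<le> c * \<sigma>" using nn \<open>s \<le> c\<close> by (intro mult_right_mono)
  then have "\<sigma> * (2 * s) < 1 * (2 * s)" using small by (simp add: \<sigma>_def[symmetric] algebra_simps)
  then have \<sigma>1: "\<sigma> < 1" using s by (simp only: mult_less_cancel_right)
  have G: "((1 - \<alpha>)\<^sup>2 + \<alpha>\<^sup>2) * ((1 - \<beta>)\<^sup>2 + \<beta>\<^sup>2) - (- ((1 - \<alpha>) * (1 - \<beta>)) + r)\<^sup>2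
      = (\<sigma> - 2 * \<pi>)\<^sup>2 - 2 * \<delta> * (1 - \<sigma>) - \<delta>\<^sup>2"
    unfolding \<sigma>_def \<pi>_def \<delta>_def by algebra
  have L: "((1 - \<alpha>)\<^sup>2 + \<alpha>\<^sup>2) + ((1 - \<beta>)\<^sup>2 + \<beta>\<^sup>2) - 2 * (- ((1 - \<alpha>) * (1 - \<beta>)) + r)
      = 4 - 4 * \<sigma> + 2 * \<sigma>\<^sup>2 - 4 * \<pi> + 2 * \<delta>"
    unfolding \<sigma>_def \<pi>_def \<delta>_def by algebra
  define F where "F = (\<lambda>p. s\<^sup>2 * (4 - 4 * \<sigma> + 2 * \<sigma>\<^sup>2 - 4 * p) - (\<sigma> - 2 * p)\<^sup>2)"
  have "F 0 = (2 * s - \<sigma> * s - c * \<sigma>) * (2 * s - \<sigma> * s + c * \<sigma>)"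
    unfolding F_def using sc by algebra
  also have "\<dots> > 0"
  proof (rule mult_pos_pos)
    show "0 < 2 * s - \<sigma> * s - c * \<sigma>"
      using small by (simp add: \<sigma>_def algebra_simps)
    then show "0 < 2 * s - \<sigma> * s + c * \<sigma>"
      using nn assms by (smt (verit) mult_nonneg_nonneg)
  qed
  finally have F0: "0 < F 0" .
  have "\<sigma> * 1 < 2 * s"
  proof -
    have "1 \<le> (s + c)\<^sup>2" using sc assms by (simp add: power2_sum)
    then have "1 \<le> s + c" using assms by (smt (verit) power_less_one_iff)
    then have "\<sigma> * 1 \<le> \<sigma> * (s + c)" using nn by (intro mult_left_mono)
    then show ?thesis using small by (simp add: \<sigma>_def)
  qed
  then have "\<sigma>\<^sup>2 < (2 * s)\<^sup>2" using nn by (intro power_strict_mono) auto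
  then have "0 < (2 - \<sigma>)\<^sup>2 * (s\<^sup>2 - \<sigma>\<^sup>2 / 4)"
    using \<sigma>1 by (intro mult_pos_pos) (auto simp: power2_eq_square)
  also have "\<dots> = F (\<sigma>\<^sup>2 / 4)" unfolding F_def by (simp add: power2_eq_square field_simps)
  finally have F1: "0 < F (\<sigma>\<^sup>2 / 4)" .
  \<comment> \<open>\<^term>\<open>F\<close> is concave, so it is positive on the range from \<open>0\<close> to \<open>\<sigma>\<^sup>2 / 4\<close> of \<open>\<pi>\<close>.\<close>
  have "0 < F \<pi>"
  proof (cases "\<pi> = 0")
    case True
    then show ?thesis using F0 by simp
  next
    case False
    then have "0 < \<pi>" using nn by simp
    then have "0 < \<sigma>\<^sup>2" using \<pi>\<sigma> by linarith
    have "0 < (\<sigma>\<^sup>2 - 4 * \<pi>) * F 0 + 4 * \<pi> * F (\<sigma>\<^sup>2 / 4)"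
      using F0 F1 \<open>0 < \<pi>\<close> \<pi>\<sigma> by (intro add_nonneg_pos) auto
    also have "\<dots> \<le> \<dots> + \<sigma>\<^sup>2 * \<pi> * (\<sigma>\<^sup>2 - 4 * \<pi>)"
      using \<pi>\<sigma> nn by simp
    also have "\<dots> = \<sigma>\<^sup>2 * F \<pi>"
      unfolding F_def by (simp add: power2_eq_square field_simps)
    finally show ?thesis using \<open>0 < \<sigma>\<^sup>2\<close> by (simp only: zero_less_mult_pos)
  qed
  moreover have "0 \<le> 2 * s\<^sup>2 * \<delta> + 2 * \<delta> * (1 - \<sigma>) + \<delta>\<^sup>2"
    using nn \<sigma>1 by simp
  ultimately show ?thesis unfolding G L F_def by (simp add: algebra_simps)
qed

section \<open>The two regimes of the formula\<close>

lemma max_chord_length_small: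
  assumes "2 * t\<^sup>2 \<le> 1" "0 \<le> t"
  shows "max_chord_length t = 2 / (t + sqrt (1 - t\<^sup>2))"
proof -
  have "t\<^sup>2 \<le> (1 / sqrt 2)\<^sup>2" using assms by (simp add: power_divide)
  then have "t \<le> 1 / sqrt 2" by (rule power2_le_imp_le) simp
  then show ?thesis by (simp add: max_chord_length_def)
qed

lemma max_chord_length_large:
  assumes "1 < 2 * t\<^sup>2" "0 \<le> t"
  shows "max_chord_length t = (if t \<le> 3 / 4 then t - sqrt (t\<^sup>2 - 1 / 2) else 2 - 2 * t)"
proof -
  have "\<not> t \<le> 1 / sqrt 2"
  proof
    assume "t \<le> 1 / sqrt 2"
    then have "t\<^sup>2 \<le> (1 / sqrt 2)\<^sup>2" using assms by (intro power_mono) auto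
    then show False using assms by (simp add: power_divide)
  qed
  then show ?thesis by (simp add: max_chord_length_def)
qed

section \<open>Chords cutting off a corner\<close>

text \<open>
  Here both \<open>i\<close>-th coordinates are at least \<open>1 / 2\<close>, with the same sign. In terms of
  \<open>\<sigma> = \<alpha> + \<beta>\<close>, \<open>\<pi> = \<alpha> * \<beta>\<close> and \<open>\<delta> = \<alpha> * \<beta> + r\<close>, planar chords across two adjacent edges are those
  with \<open>\<delta> = 0\<close>, and for them \<open>t * L \<le> \<sigma> - \<sigma>\<^sup>2 + L\<^sup>2 / 2\<close>. The maximum over \<open>\<sigma>\<close> is at \<open>\<sigma> = 1 / 2\<close> and gives
  \<open>t * L \<le> 1 / 4 + L\<^sup>2 / 2\<close>, the quadratic inequality behind the second case. Since \<open>\<sigma> \<le> L\<close> for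
  these chords, short ones with \<open>L \<le> 1 / 2\<close> do not reach that maximum; the best they can do is
  \<open>\<sigma> = L\<close>, which gives \<open>L \<le> 2 - 2 * t\<close>. The work consists in showing that \<open>\<delta> > 0\<close> cannot beat this.
\<close>

lemma corner_bound:
  fixes \<alpha> \<beta> r t L :: real
  assumes "0 \<le> \<alpha>" "\<alpha> \<le> 1 / 2" "0 \<le> \<beta>" "\<beta> \<le> 1 / 2" and r: "\<bar>r\<bar> \<le> \<alpha> * \<beta>"
    and t: "0 \<le> t" "1 < 2 * t\<^sup>2" and "t \<le> 1" and "0 \<le> L"
    and L: "L\<^sup>2 = ((1 - \<alpha>)\<^sup>2 + \<alpha>\<^sup>2) + ((1 - \<beta>)\<^sup>2 + \<beta>\<^sup>2) - 2 * ((1 - \<alpha>) * (1 - \<beta>) + r)"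
    and gram: "t\<^sup>2 * L\<^sup>2 \<le> ((1 - \<alpha>)\<^sup>2 + \<alpha>\<^sup>2) * ((1 - \<beta>)\<^sup>2 + \<beta>\<^sup>2) - ((1 - \<alpha>) * (1 - \<beta>) + r)\<^sup>2"
  shows "L \<le> max_chord_length t"
proof -
  define \<sigma> \<pi> \<delta> where "\<sigma> = \<alpha> + \<beta>" and "\<pi> = \<alpha> * \<beta>" and "\<delta> = \<alpha> * \<beta> + r"
  have nn: "0 \<le> \<sigma>" "0 \<le> \<pi>" "0 \<le> \<delta>" "\<delta> \<le> 2 * \<pi>" "\<sigma> \<le> 1"
    using assms by (auto simp: \<sigma>_def \<pi>_def \<delta>_def)
  have \<pi>\<sigma>: "4 * \<pi> \<le> \<sigma>\<^sup>2"
    using zero_le_power2[of "\<alpha> - \<beta>"] by (simp add: \<sigma>_def \<pi>_def power2_eq_square algebra_simps)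
  have "0 \<le> (1 / 2 - \<alpha>) * (1 / 2 - \<beta>)" using assms by (intro mult_nonneg_nonneg) auto
  then have \<sigma>\<pi>: "\<sigma> - 1 / 2 \<le> 2 * \<pi>" by (simp add: \<sigma>_def \<pi>_def algebra_simps)
  have "\<sigma>\<^sup>2 \<le> \<sigma> * 1" using nn unfolding power2_eq_square by (intro mult_left_mono)
  then have \<sigma>2: "\<sigma>\<^sup>2 \<le> \<sigma>" by simp
  have G: "((1 - \<alpha>)\<^sup>2 + \<alpha>\<^sup>2) * ((1 - \<beta>)\<^sup>2 + \<beta>\<^sup>2) - ((1 - \<alpha>) * (1 - \<beta>) + r)\<^sup>2
      = (\<sigma> - 2 * \<pi>)\<^sup>2 - 2 * \<delta> * (1 - \<sigma>) - \<delta>\<^sup>2"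
    unfolding \<sigma>_def \<pi>_def \<delta>_def by algebra
  have L2: "L\<^sup>2 = 2 * \<sigma>\<^sup>2 - 4 * \<pi> - 2 * \<delta>"
    unfolding L \<sigma>_def \<pi>_def \<delta>_def by algebra
  have gram': "(t * L)\<^sup>2 \<le> (\<sigma> - 2 * \<pi>)\<^sup>2 - 2 * \<delta> * (1 - \<sigma>) - \<delta>\<^sup>2"
    using gram unfolding G by (simp add: power_mult_distrib)
  \<comment> \<open>The difference of the two sides is a quadratic polynomial in \<open>\<delta>\<close> whose linear coefficient
      \<open>- 2 * E\<close> can only hurt if \<open>\<sigma> > 1 / 2\<close>; then \<open>\<alpha>, \<beta> \<le> 1 / 2\<close> forces \<open>\<pi>\<close> to be large and \<open>E\<close> small.\<close>
  have mid: "(\<sigma> - 2 * \<pi>)\<^sup>2 - 2 * \<delta> * (1 - \<sigma>) - \<delta>\<^sup>2 \<le> (1 / 4 + L\<^sup>2 / 2)\<^sup>2"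
  proof -
    define E where "E = \<sigma> + \<sigma>\<^sup>2 - 3 / 4 - 2 * \<pi>"
    have "E\<^sup>2 \<le> (\<sigma> - 1 / 2)\<^sup>2 * (2 * (1 / 4 + \<sigma>\<^sup>2 + \<sigma> - 4 * \<pi>)) \<or> E \<le> 0"
    proof (cases "E \<le> 0")
      case False
      have "E \<le> (\<sigma> - 1 / 2) * (\<sigma> + 1 / 2)"
        using \<sigma>\<pi> unfolding E_def by (simp add: field_simps power2_eq_square)
      then have "E\<^sup>2 \<le> ((\<sigma> - 1 / 2) * (\<sigma> + 1 / 2))\<^sup>2"
        using False by (intro power_mono) auto
      also have "\<dots> = (\<sigma> - 1 / 2)\<^sup>2 * (\<sigma> + 1 / 2)\<^sup>2" by (rule power_mult_distrib)
      also have "\<dots> \<le> (\<sigma> - 1 / 2)\<^sup>2 * (2 * (1 / 4 + \<sigma>\<^sup>2 + \<sigma> - 4 * \<pi>))"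
        using \<pi>\<sigma> \<sigma>2 nn by (intro mult_left_mono) (auto simp: power2_sum power_divide)
      finally show ?thesis by (rule disjI1)
    qed simp
    moreover have "0 \<le> (\<sigma> - 1 / 2)\<^sup>2 * (1 / 4 + \<sigma>\<^sup>2 + \<sigma> - 4 * \<pi>)"
      using \<pi>\<sigma> nn by (intro mult_nonneg_nonneg) auto
    moreover have "(1 / 4 + L\<^sup>2 / 2)\<^sup>2 - ((\<sigma> - 2 * \<pi>)\<^sup>2 - 2 * \<delta> * (1 - \<sigma>) - \<delta>\<^sup>2)
        = (\<sigma> - 1 / 2)\<^sup>2 * (1 / 4 + \<sigma>\<^sup>2 + \<sigma> - 4 * \<pi>) + 2 * \<delta> * (\<delta> - E)"
      unfolding L2 E_def by (simp add: power2_eq_square field_simps)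
    moreover have "2 * \<delta> * (\<delta> - E) = 2 * (\<delta> - E / 2)\<^sup>2 - E\<^sup>2 / 2"
      by (simp add: power2_eq_square field_simps)
    moreover have "E \<le> 0 \<Longrightarrow> 0 \<le> 2 * \<delta> * (\<delta> - E)"
      using nn by simp
    moreover have "0 \<le> (\<delta> - E / 2)\<^sup>2" by simp
    ultimately show ?thesis by linarith
  qed
  have "(t * L)\<^sup>2 \<le> (1 / 4 + L\<^sup>2 / 2)\<^sup>2" using gram' mid by linarith
  then have tL: "t * L \<le> 1 / 4 + L\<^sup>2 / 2" by (rule power2_le_imp_le) simp
  \<comment> \<open>With this, only values of \<open>L\<close> up to the smaller root of the quadratic inequality \<open>tL\<close> remain.\<close>
  have L_half: "L\<^sup>2 \<le> 1 / 2"
  proof (rule ccontr)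
    assume "\<not> ?thesis"
    then have "1 * L\<^sup>2 < 2 * t\<^sup>2 * L\<^sup>2" using t by (intro mult_strict_right_mono) auto
    then have "0 < 2 * ((\<sigma> - 2 * \<pi>)\<^sup>2 - 2 * \<delta> * (1 - \<sigma>) - \<delta>\<^sup>2) - L\<^sup>2"
      using gram' by (simp add: power_mult_distrib)
    also have "\<dots> = 2 * (2 * \<pi> - \<delta>) * (1 - 2 * \<sigma> + (2 * \<pi> + \<delta>))"
      unfolding L2 by (simp add: power2_eq_square field_simps)
    finally have "0 < 1 - 2 * \<sigma> + (2 * \<pi> + \<delta>)"
      using nn by (simp add: zero_less_mult_iff)
    then have "\<sigma>\<^sup>2 \<le> ((1 + (2 * \<pi> + \<delta>)) / 2)\<^sup>2" using nn by (intro power_mono) auto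
    moreover have "(2 * \<pi> + \<delta>)\<^sup>2 \<le> (2 * \<pi> + \<delta>) * 2"
      using nn \<pi>\<sigma> \<sigma>2 unfolding power2_eq_square by (intro mult_left_mono) auto
    ultimately show False
      using \<open>\<not> L\<^sup>2 \<le> 1 / 2\<close> unfolding L2 by (simp add: power2_eq_square field_simps)
  qed
  define w where "w = sqrt (t\<^sup>2 - 1 / 2)"
  have w: "0 \<le> w" "w\<^sup>2 = t\<^sup>2 - 1 / 2" using t by (simp_all add: w_def)
  have "L < t"
  proof (rule power2_less_imp_less)
    show "L\<^sup>2 < t\<^sup>2" using L_half t by simp
  qed (fact t)
  have Lw: "L \<le> t - w"
  proof (rule ccontr)
    assume "\<not> ?thesis"
    then have "(t - L)\<^sup>2 < w\<^sup>2" using \<open>L < t\<close> by (intro power_strict_mono) auto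
    then show False using tL w by (simp add: power2_eq_square algebra_simps)
  qed
  show ?thesis
  proof (cases "t \<le> 3 / 4")
    case True
    then show ?thesis using Lw t by (simp add: max_chord_length_large w_def)
  next
    case False
    have "(1 / 4)\<^sup>2 < w\<^sup>2"
      unfolding w using False power_strict_mono[of "3 / 4" t 2] by (simp add: power_divide)
    have "1 / 4 < w" using \<open>(1 / 4)\<^sup>2 < w\<^sup>2\<close> w(1) by (rule power2_less_imp_less)
    then have "L * 1 \<le> L * (t + w)" using False \<open>0 \<le> L\<close> by (intro mult_left_mono) auto
    also have "\<dots> \<le> (t - w) * (t + w)" using Lw w t by (intro mult_right_mono) auto
    also have "\<dots> = 1 / 2" using w by (simp add: power2_eq_square algebra_simps)
    finally have "L \<le> 1 / 2" by simp
    \<comment> \<open>For fixed \<open>\<sigma>\<close> and \<open>L\<close> the Gram determinant is affine in \<open>\<delta>\<close>, so it is largest at one end of the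
        range of \<open>\<delta>\<close>; which end depends on the sign of \<open>(1 - \<sigma>)\<^sup>2 - L\<^sup>2 / 2\<close>.\<close>
    have "(t * L)\<^sup>2 \<le> (L * (1 - L / 2))\<^sup>2"
    proof (cases "\<sigma> \<le> L")
      case True
      have "(\<sigma> - 2 * \<pi>)\<^sup>2 - 2 * \<delta> * (1 - \<sigma>) - \<delta>\<^sup>2
          = (\<sigma> - \<sigma>\<^sup>2 + L\<^sup>2 / 2)\<^sup>2 - 2 * \<delta> * ((1 - \<sigma>)\<^sup>2 - L\<^sup>2 / 2)"
        unfolding L2 by (simp add: power2_eq_square field_simps)
      moreover have "(1 / 2)\<^sup>2 \<le> (1 - \<sigma>)\<^sup>2" using True \<open>L \<le> 1 / 2\<close> by (intro power_mono) auto
      moreover have "L\<^sup>2 \<le> (1 / 2)\<^sup>2" using \<open>0 \<le> L\<close> \<open>L \<le> 1 / 2\<close> by (intro power_mono) auto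
      then have "0 \<le> 2 * \<delta> * ((1 - \<sigma>)\<^sup>2 - L\<^sup>2 / 2)"
        using nn \<open>(1 / 2)\<^sup>2 \<le> (1 - \<sigma>)\<^sup>2\<close> by (intro mult_nonneg_nonneg) (auto simp: power_divide)
      ultimately have "(t * L)\<^sup>2 \<le> (\<sigma> - \<sigma>\<^sup>2 + L\<^sup>2 / 2)\<^sup>2"
        using gram' by linarith
      also have "\<dots> \<le> (L * (1 - L / 2))\<^sup>2"
      proof (rule power_mono)
        have "0 \<le> (L - \<sigma>) * (1 - L - \<sigma>)"
          using True \<open>L \<le> 1 / 2\<close> by (intro mult_nonneg_nonneg) auto
        then show "\<sigma> - \<sigma>\<^sup>2 + L\<^sup>2 / 2 \<le> L * (1 - L / 2)"
          by (simp add: power2_eq_square field_simps)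
      qed (use \<sigma>2 in simp)
      finally show ?thesis .
    next
      case False
      have G': "(\<sigma> - 2 * \<pi>)\<^sup>2 - 2 * \<delta> * (1 - \<sigma>) - \<delta>\<^sup>2
          = (\<sigma> - \<sigma>\<^sup>2 + L\<^sup>2 / 2)\<^sup>2 - 2 * \<delta> * ((1 - \<sigma>)\<^sup>2 - L\<^sup>2 / 2)"
        unfolding L2 by (simp add: power2_eq_square field_simps)
      \<comment> \<open>These are the constraints \<open>4 * \<pi> \<le> \<sigma>\<^sup>2\<close> and \<open>\<delta> \<le> 2 * \<pi>\<close> with \<open>\<pi>\<close> eliminated by \<open>L2\<close>.\<close>
      have lower: "\<sigma>\<^sup>2 - L\<^sup>2 \<le> 2 * \<delta>" using \<pi>\<sigma> L2 by simp
      have upper: "2 * \<delta> \<le> \<sigma>\<^sup>2 - L\<^sup>2 / 2" using nn L2 by linarith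
      show ?thesis
      proof (cases "L\<^sup>2 / 2 \<le> (1 - \<sigma>)\<^sup>2")
        case True
        have "(\<sigma>\<^sup>2 - L\<^sup>2) * ((1 - \<sigma>)\<^sup>2 - L\<^sup>2 / 2) \<le> 2 * \<delta> * ((1 - \<sigma>)\<^sup>2 - L\<^sup>2 / 2)"
          using lower True by (intro mult_right_mono) auto
        then have "(t * L)\<^sup>2 \<le> (\<sigma> - \<sigma>\<^sup>2 + L\<^sup>2 / 2)\<^sup>2 - (\<sigma>\<^sup>2 - L\<^sup>2) * ((1 - \<sigma>)\<^sup>2 - L\<^sup>2 / 2)"
          using gram' G' by linarith
        also have "\<dots> = L\<^sup>2 * (1 - \<sigma> + \<sigma>\<^sup>2 / 2 - L\<^sup>2 / 4)"
          by (simp add: power2_eq_square field_simps)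
        also have "\<dots> \<le> L\<^sup>2 * (1 - L / 2)\<^sup>2"
        proof (rule mult_left_mono)
          have "0 \<le> (\<sigma> - L) * (2 - \<sigma> - L)"
            using \<open>\<not> \<sigma> \<le> L\<close> \<open>L \<le> 1 / 2\<close> nn by (intro mult_nonneg_nonneg) auto
          then show "1 - \<sigma> + \<sigma>\<^sup>2 / 2 - L\<^sup>2 / 4 \<le> (1 - L / 2)\<^sup>2"
            by (simp add: power2_eq_square field_simps)
        qed simp
        finally show ?thesis by (simp add: power_mult_distrib)
      next
        case False
        have "2 * \<delta> * (L\<^sup>2 / 2 - (1 - \<sigma>)\<^sup>2) \<le> (\<sigma>\<^sup>2 - L\<^sup>2 / 2) * (L\<^sup>2 / 2 - (1 - \<sigma>)\<^sup>2)"
          using upper False by (intro mult_right_mono) auto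
        then have "(t * L)\<^sup>2 \<le> (\<sigma> - \<sigma>\<^sup>2 + L\<^sup>2 / 2)\<^sup>2 + (\<sigma>\<^sup>2 - L\<^sup>2 / 2) * (L\<^sup>2 / 2 - (1 - \<sigma>)\<^sup>2)"
          using gram' G' by (simp add: algebra_simps)
        also have "\<dots> = L\<^sup>2 * (1 / 2)"
          by (simp add: power2_eq_square field_simps)
        also have "\<dots> \<le> L\<^sup>2 * (1 - L / 2)\<^sup>2"
          using power_mono[of "3 / 4" "1 - L / 2" 2] \<open>L \<le> 1 / 2\<close>
          by (intro mult_left_mono) (auto simp: power_divide)
        finally show ?thesis by (simp add: power_mult_distrib)
      qed
    qed
    then have "t * L \<le> L * (1 - L / 2)"
      using \<open>0 \<le> L\<close> \<open>L \<le> 1 / 2\<close> by (intro power2_le_imp_le[of "t * L"]) auto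
    then have "L * t \<le> L * (1 - L / 2)" by (simp add: mult.commute)
    then have "L \<le> 2 - 2 * t"
      using \<open>0 \<le> L\<close> \<open>t \<le> 1\<close> by (cases "L = 0") auto
    then show ?thesis using False t by (simp add: max_chord_length_large)
  qed
qed

text \<open>
  Otherwise some point of the segment has \<open>i\<close>-th coordinate \<open>\<epsilon> / 2\<close>; its remaining coordinates have
  \<open>l\<^sup>1\<close> norm at most \<open>1 / 2\<close>, so its squared norm is at most \<open>1 / 2\<close>, too small for distance \<open>t\<close>.
\<close>

lemma dominant_coordinate_constant:
  fixes x y :: "real ^ 'n"
  assumes x: "x \<in> cross_polytope" and y: "y \<in> cross_polytope"
    and far: "\<And>s. t \<le> norm (x + s *\<^sub>R (y - x))" and t: "0 \<le> t" "1 < 2 * t\<^sup>2"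
    and xi: "1 / 2 < \<epsilon> * x $ i" and \<epsilon>: "\<bar>\<epsilon>\<bar> = 1"
  shows "1 / 2 < \<epsilon> * y $ i"
proof (rule ccontr)
  assume yi: "\<not> 1 / 2 < \<epsilon> * y $ i"
  define s where "s = (\<epsilon> * x $ i - 1 / 2) / (\<epsilon> * x $ i - \<epsilon> * y $ i)"
  have s: "0 \<le> s" "s \<le> 1" using xi yi by (auto simp: s_def divide_simps)
  let ?z = "x + s *\<^sub>R (y - x)"
  have "?z = (1 - s) *\<^sub>R x + s *\<^sub>R y" by (simp add: algebra_simps)
  then have z: "?z \<in> cross_polytope"
    using convexD[OF convex_cross_polytope x y, of "1 - s" s] s by simp
  have "\<epsilon> * ?z $ i = \<epsilon> * x $ i - s * (\<epsilon> * x $ i - \<epsilon> * y $ i)"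
    by (simp add: algebra_simps)
  moreover have "\<epsilon> * x $ i - \<epsilon> * y $ i \<noteq> 0" using xi yi by linarith
  then have "\<epsilon> * x $ i - s * (\<epsilon> * x $ i - \<epsilon> * y $ i) = 1 / 2"
    unfolding s_def by (simp only: nonzero_eq_divide_eq times_divide_eq_left) simp
  ultimately have "\<bar>\<epsilon>\<bar> * \<bar>?z $ i\<bar> = 1 / 2" by (metis abs_mult abs_of_pos half_gt_zero zero_less_one)
  then have zi: "\<bar>?z $ i\<bar> = 1 / 2" using \<epsilon> by simp
  then have "(?z $ i)\<^sup>2 = (1 / 2)\<^sup>2" by (metis power2_abs)
  then have "(norm ?z)\<^sup>2 \<le> (1 / 2)\<^sup>2 + (1 - 1 / 2)\<^sup>2"
    using norm_le_in_cross_polytope[OF z, of i] unfolding zi by simp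
  then have "(norm ?z)\<^sup>2 \<le> 1 / 2" by (simp add: power2_eq_square)
  moreover have "t\<^sup>2 \<le> (norm ?z)\<^sup>2" using far[of s] t by (intro power_mono)
  ultimately show False using t by simp
qed

section \<open>The upper bound\<close>

lemma chord_bound_near:
  fixes x y :: "real ^ 'n"
  assumes x: "x \<in> cross_polytope" and y: "y \<in> cross_polytope"
    and far: "\<And>s. t \<le> norm (x + s *\<^sub>R (y - x))" and t: "0 \<le> t" "2 * t\<^sup>2 \<le> 1"
  shows "norm (x - y) \<le> max_chord_length t"
proof (rule ccontr)
  assume "\<not> ?thesis"
  define c where "c = sqrt (1 - t\<^sup>2)"
  have c: "0 \<le> c" "t\<^sup>2 + c\<^sup>2 = 1" using t by (simp_all add: c_def)
  have "t \<le> c" using t c by (intro power2_le_imp_le[of t c]) linarith+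
  have "0 < t + c" using t c by (smt (verit) power_zero_numeral)
  define N where "N = norm (x - y)"
  have "2 / (t + c) < N"
    using \<open>\<not> norm (x - y) \<le> max_chord_length t\<close> t
    by (simp add: max_chord_length_small N_def c_def)
  then have long: "2 < N * (t + c)" using \<open>0 < t + c\<close> by (simp add: field_simps)
  have "(\<Sum>k\<in>UNIV. \<bar>x $ k - y $ k\<bar>) \<le> (\<Sum>k\<in>UNIV. \<bar>x $ k\<bar> + \<bar>y $ k\<bar>)"
    by (intro sum_mono) simp
  also have "\<dots> \<le> 2" using x y by (simp add: cross_polytope_def sum.distrib)
  finally have "(\<Sum>k\<in>UNIV. \<bar>x $ k - y $ k\<bar>) \<le> 2" .
  moreover have "(\<Sum>k\<in>UNIV. \<bar>x $ k - y $ k\<bar>\<^sup>2) = N\<^sup>2" "0 \<le> N"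
    unfolding N_def power2_norm_eq_inner inner_vec_def by (simp_all add: power2_eq_square)
  ultimately obtain i where i: "c * N < \<bar>x $ i - y $ i\<bar>"
    using exists_long_coordinate[of "\<lambda>k. \<bar>x $ k - y $ k\<bar>" N t c] t c \<open>t \<le> c\<close> long by auto
  have ci: "2 * c < \<bar>x $ i - y $ i\<bar> * (t + c)"
  proof -
    have "c * 2 \<le> c * (N * (t + c))" using long c by (intro mult_left_mono) auto
    also have "\<dots> < \<bar>x $ i - y $ i\<bar> * (t + c)"
      using i \<open>0 < t + c\<close> by (simp add: mult.assoc[symmetric])
    finally show ?thesis by simp
  qed
  define \<alpha> \<beta> where "\<alpha> = 1 - \<bar>x $ i\<bar>" and "\<beta> = 1 - \<bar>y $ i\<bar>"
  have \<alpha>\<beta>: "0 \<le> \<alpha>" "0 \<le> \<beta>"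
    using component_le_norm_cart[of x i] component_le_norm_cart[of y i]
      norm_le_1_in_cross_polytope[OF x] norm_le_1_in_cross_polytope[OF y]
    by (auto simp: \<alpha>_def \<beta>_def)
  \<comment> \<open>As \<open>\<bar>x\<^sub>i\<bar>\<close> and \<open>\<bar>y\<^sub>i\<bar>\<close> are at most \<open>1\<close>, a difference above \<open>1\<close> forces opposite signs.\<close>
  have "1 * (t + c) < \<bar>x $ i - y $ i\<bar> * (t + c)" using ci \<open>t \<le> c\<close> unfolding mult_1 by linarith
  then have "1 < \<bar>x $ i - y $ i\<bar>" using \<open>0 < t + c\<close> by simp
  then have opp: "x $ i * y $ i = - ((1 - \<alpha>) * (1 - \<beta>))" "\<bar>x $ i - y $ i\<bar> = 2 - (\<alpha> + \<beta>)"
    using \<alpha>\<beta> by (auto simp: \<alpha>_def \<beta>_def abs_if split: if_splits)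
  have "(\<alpha> + \<beta>) * (t + c) < 2 * t"
    using ci unfolding opp by (simp add: algebra_simps)
  moreover have "t\<^sup>2 \<le> (norm x)\<^sup>2" "t\<^sup>2 \<le> (norm y)\<^sup>2"
    using far[of 0] far[of 1] t power_mono[of t _ 2] by auto
  then obtain r where "\<bar>r\<bar> \<le> \<alpha> * \<beta>"
    and "t\<^sup>2 * (((1 - \<alpha>)\<^sup>2 + \<alpha>\<^sup>2) + ((1 - \<beta>)\<^sup>2 + \<beta>\<^sup>2) - 2 * (- ((1 - \<alpha>) * (1 - \<beta>)) + r))
      \<le> ((1 - \<alpha>)\<^sup>2 + \<alpha>\<^sup>2) * ((1 - \<beta>)\<^sup>2 + \<beta>\<^sup>2) - (- ((1 - \<alpha>) * (1 - \<beta>)) + r)\<^sup>2"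
    using gram_relaxation[OF x y gram_ge_of_line_far[OF far t(1)] _ _ \<alpha>_def \<beta>_def]
    unfolding opp by metis
  ultimately show False
    using opposite_facets_infeasible[of \<alpha> \<beta> r t c] \<alpha>\<beta> t c \<open>t \<le> c\<close> by simp
qed

lemma chord_bound_far:
  fixes x y :: "real ^ 'n"
  assumes x: "x \<in> cross_polytope" and y: "y \<in> cross_polytope"
    and far: "\<And>s. t \<le> norm (x + s *\<^sub>R (y - x))" and t: "0 \<le> t" "1 < 2 * t\<^sup>2" "t \<le> 1"
  shows "norm (x - y) \<le> max_chord_length t"
proof -
  have tt: "t\<^sup>2 \<le> (norm x)\<^sup>2" "t\<^sup>2 \<le> (norm y)\<^sup>2"
    using far[of 0] far[of 1] t power_mono[of t _ 2] by auto
  then obtain i where i: "1 / 2 < \<bar>x $ i\<bar>"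
    using exists_coordinate_gt_half[OF x] t by fastforce
  define \<epsilon> where "\<epsilon> = sgn (x $ i)"
  have \<epsilon>: "\<bar>\<epsilon>\<bar> = 1" "1 / 2 < \<epsilon> * x $ i"
    using i by (auto simp: \<epsilon>_def abs_sgn_eq mult.commute[of "sgn _"] abs_sgn[symmetric])
  have "1 / 2 < \<epsilon> * y $ i"
    using dominant_coordinate_constant[OF x y far t(1,2) \<epsilon>(2,1)] .
  define \<alpha> \<beta> where "\<alpha> = 1 - \<bar>x $ i\<bar>" and "\<beta> = 1 - \<bar>y $ i\<bar>"
  have same: "x $ i * y $ i = (1 - \<alpha>) * (1 - \<beta>)" "\<alpha> \<le> 1 / 2" "\<beta> \<le> 1 / 2"
    using \<epsilon> \<open>1 / 2 < \<epsilon> * y $ i\<close> by (auto simp: \<alpha>_def \<beta>_def abs_if split: if_splits)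
  have \<alpha>\<beta>: "0 \<le> \<alpha>" "0 \<le> \<beta>"
    using component_le_norm_cart[of x i] component_le_norm_cart[of y i]
      norm_le_1_in_cross_polytope[OF x] norm_le_1_in_cross_polytope[OF y]
    by (auto simp: \<alpha>_def \<beta>_def)
  \<comment> \<open>the squared length of the relaxed chord\<close>
  define \<Lambda> where "\<Lambda> = (\<lambda>r. ((1 - \<alpha>)\<^sup>2 + \<alpha>\<^sup>2) + ((1 - \<beta>)\<^sup>2 + \<beta>\<^sup>2) - 2 * ((1 - \<alpha>) * (1 - \<beta>) + r))"
  obtain r where r: "\<bar>r\<bar> \<le> \<alpha> * \<beta>" and N: "(norm (x - y))\<^sup>2 \<le> \<Lambda> r"
    and gram: "t\<^sup>2 * \<Lambda> r \<le> ((1 - \<alpha>)\<^sup>2 + \<alpha>\<^sup>2) * ((1 - \<beta>)\<^sup>2 + \<beta>\<^sup>2) - ((1 - \<alpha>) * (1 - \<beta>) + r)\<^sup>2"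
    using gram_relaxation[OF x y gram_ge_of_line_far[OF far t(1)] tt \<alpha>_def \<beta>_def]
    unfolding same(1) \<Lambda>_def by metis
  have \<Lambda>: "0 \<le> \<Lambda> r" using N by (meson order_trans zero_le_power2)
  have "norm (x - y) \<le> sqrt (\<Lambda> r)" using N by (rule real_le_rsqrt)
  also have "\<dots> \<le> max_chord_length t"
    using \<Lambda> gram by (intro corner_bound[OF \<alpha>\<beta>(1) same(2) \<alpha>\<beta>(2) same(3) r t(1,2,3)]) (auto simp: \<Lambda>_def)
  finally show ?thesis .
qed

lemma chord_bound:
  fixes x y :: "real ^ 'n"
  assumes "x \<in> cross_polytope" "y \<in> cross_polytope"
    and "\<And>s. t \<le> norm (x + s *\<^sub>R (y - x))" "0 \<le> t" "t \<le> 1"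
  shows "norm (x - y) \<le> max_chord_length t"
  using chord_bound_near[of x y t] chord_bound_far[of x y t] assms by fastforce

lemma chord_parameters_interval:
  fixes p u :: "real ^ 'n"
  assumes u: "norm u = 1"
  obtains a b where "{s. p + s *\<^sub>R u \<in> cross_polytope} = {a..b}"
proof -
  let ?S = "{s. p + s *\<^sub>R u \<in> cross_polytope}"
  have S: "?S = (\<lambda>s. p + s *\<^sub>R u) -` cross_polytope" by auto
  have "closed ?S"
    unfolding S by (intro closed_vimage closed_cross_polytope continuous_intros)
  moreover have "bounded ?S"
  proof (rule boundedI)
    fix s assume "s \<in> ?S"
    then have "norm (p + s *\<^sub>R u) \<le> 1" using norm_le_1_in_cross_polytope by blast
    moreover have "norm (s *\<^sub>R u) \<le> norm (p + s *\<^sub>R u) + norm p"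
      using norm_triangle_ineq4[of "p + s *\<^sub>R u" p] by simp
    ultimately show "norm s \<le> 1 + norm p" using u by simp
  qed
  moreover have "connected ?S"
  proof (intro convex_connected convexI)
    fix s s' a b :: real
    assume *: "s \<in> ?S" "s' \<in> ?S" "0 \<le> a" "0 \<le> b" "a + b = 1"
    have "p + (a * s + b * s') *\<^sub>R u = (a + b) *\<^sub>R p + (a * s + b * s') *\<^sub>R u"
      using * by simp
    also have "\<dots> = a *\<^sub>R (p + s *\<^sub>R u) + b *\<^sub>R (p + s' *\<^sub>R u)"
      by (simp add: algebra_simps)
    finally show "a *\<^sub>R s + b *\<^sub>R s' \<in> ?S"
      using * convexD[OF convex_cross_polytope] by simp
  qed
  ultimately have "\<exists>a b. ?S = {a..b}"
    using connected_compact_interval_1[of ?S] by (simp add: compact_eq_bounded_closed cbox_interval)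
  then show thesis using that by blast
qed

lemma length_on_le_max_chord_length:
  fixes L :: "(real ^ 'n) set"
  assumes L: "L \<in> lines_at_distance t" and t: "0 \<le> t" "t \<le> 1"
  shows "length_on L cross_polytope \<le> max_chord_length t"
proof -
  obtain p u where u: "norm u = 1" and Lpu: "L = range (\<lambda>s. p + s *\<^sub>R u)"
    using L is_line_parametrization[of L] unfolding lines_at_distance_def by blast
  have far: "t \<le> norm (p + s *\<^sub>R u)" for s
    using L infdist_le[of "p + s *\<^sub>R u" L 0] Lpu by (auto simp: lines_at_distance_def)
  obtain a b where ab: "{s. p + s *\<^sub>R u \<in> cross_polytope} = {a..b}"
    using chord_parameters_interval[OF u] by blast
  have len: "length_on L cross_polytope = measure lebesgue {a..b}"
    unfolding length_on_eq[OF u Lpu] ab ..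
  show ?thesis
  proof (cases "a \<le> b")
    case True
    let ?x = "p + a *\<^sub>R u" and ?y = "p + b *\<^sub>R u"
    have "?x \<in> cross_polytope" "?y \<in> cross_polytope" using True ab by auto
    moreover have "t \<le> norm (?x + s *\<^sub>R (?y - ?x))" for s
    proof -
      have "?x + s *\<^sub>R (?y - ?x) = p + (a + s * (b - a)) *\<^sub>R u" by (simp add: algebra_simps)
      then show ?thesis using far by metis
    qed
    ultimately have "norm (?x - ?y) \<le> max_chord_length t" using t by (intro chord_bound)
    moreover have "?x - ?y = (a - b) *\<^sub>R u" by (simp add: algebra_simps)
    ultimately show ?thesis using True u len by simp
  next
    case False
    \<comment> \<open>The line misses the cross-polytope.\<close>
    have "length_on L cross_polytope = 0" using False len by simp
    also have "0 \<le> max_chord_length t"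
    proof (cases "2 * t\<^sup>2 \<le> 1")
      case True
      then show ?thesis using t by (simp add: max_chord_length_small)
    next
      case False
      have "sqrt (t\<^sup>2 - 1 / 2) \<le> t" using t by (intro real_le_lsqrt) auto
      then show ?thesis using t False by (simp add: max_chord_length_large)
    qed
    finally show ?thesis .
  qed
qed

section \<open>Extremal chords in a coordinate plane\<close>

lemma infdist_line:
  fixes p u :: "'a::euclidean_space"
  assumes u: "norm u = 1"
  shows "infdist 0 (range (\<lambda>s. p + s *\<^sub>R u)) = sqrt ((norm p)\<^sup>2 - (p \<bullet> u)\<^sup>2)"
proof -
  have uu: "u \<bullet> u = 1" using u by (simp add: norm_eq_1)
  have *: "(norm (p + s *\<^sub>R u))\<^sup>2 = ((norm p)\<^sup>2 - (p \<bullet> u)\<^sup>2) + (s + p \<bullet> u)\<^sup>2" for s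
    unfolding power2_norm_eq_inner using uu by (simp add: algebra_simps inner_commute power2_eq_square)
  show ?thesis
  proof (rule antisym)
    have "(norm (p + (- (p \<bullet> u)) *\<^sub>R u)) = sqrt ((norm p)\<^sup>2 - (p \<bullet> u)\<^sup>2)"
      using *[of "- (p \<bullet> u)"] by (metis add.left_inverse add.right_neutral norm_ge_zero power_zero_numeral real_sqrt_unique)
    moreover have "p + (- (p \<bullet> u)) *\<^sub>R u \<in> range (\<lambda>s. p + s *\<^sub>R u)" by blast
    ultimately show "infdist 0 (range (\<lambda>s. p + s *\<^sub>R u)) \<le> sqrt ((norm p)\<^sup>2 - (p \<bullet> u)\<^sup>2)"
      using infdist_le by (metis dist_0_norm)
    have "sqrt ((norm p)\<^sup>2 - (p \<bullet> u)\<^sup>2) \<le> norm (p + s *\<^sub>R u)" for s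
      by (rule real_le_lsqrt) (simp_all add: *)
    then show "sqrt ((norm p)\<^sup>2 - (p \<bullet> u)\<^sup>2) \<le> infdist 0 (range (\<lambda>s. p + s *\<^sub>R u))"
      by (auto simp: infdist_def intro!: cINF_greatest)
  qed
qed

text \<open>
  The line through the point \<open>(p\<^sub>1, p\<^sub>2)\<close> in the unit direction \<open>(u\<^sub>1, u\<^sub>2)\<close> of the plane spanned by \<open>e\<^sub>i\<close> and \<open>e\<^sub>j\<close> has
  distance \<open>\<bar>p\<^sub>1 * u\<^sub>2 - p\<^sub>2 * u\<^sub>1\<bar>\<close> from the origin. Only a lower bound for the length is needed,
  since the upper bound holds for all lines.
\<close>

lemma planar_chord:
  fixes i j :: "'n::finite" and p\<^sub>1 p\<^sub>2 u\<^sub>1 u\<^sub>2 :: real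
  assumes ij: "i \<noteq> j" and u: "u\<^sub>1\<^sup>2 + u\<^sub>2\<^sup>2 = 1" and det: "p\<^sub>1 * u\<^sub>2 - p\<^sub>2 * u\<^sub>1 = t" and "0 \<le> t" "0 \<le> l"
    and p: "\<bar>p\<^sub>1\<bar> + \<bar>p\<^sub>2\<bar> \<le> 1" and q: "\<bar>p\<^sub>1 + l * u\<^sub>1\<bar> + \<bar>p\<^sub>2 + l * u\<^sub>2\<bar> \<le> 1"
  shows "\<exists>L \<in> lines_at_distance t. L \<subseteq> span {axis i 1, axis j 1} \<and>
    l \<le> length_on L (cross_polytope :: (real ^ 'n) set)"
proof -
  define v where "v = (\<lambda>a b. a *\<^sub>R axis i 1 + b *\<^sub>R axis j 1 :: real ^ 'n)"
  have add: "v a b + s *\<^sub>R v a' b' = v (a + s * a') (b + s * b')" for a b s a' b'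
    by (simp add: v_def algebra_simps)
  have inner: "v a b \<bullet> v a' b' = a * a' + b * b'" for a b a' b'
    using ij by (simp add: v_def inner_axis_axis algebra_simps)
  have nrm: "(norm (v a b))\<^sup>2 = a\<^sup>2 + b\<^sup>2" for a b
    unfolding power2_norm_eq_inner inner by (simp add: power2_eq_square)
  have mem: "v a b \<in> cross_polytope \<longleftrightarrow> \<bar>a\<bar> + \<bar>b\<bar> \<le> 1" for a b
  proof -
    have "(\<Sum>k\<in>UNIV. \<bar>v a b $ k\<bar>) = (\<Sum>k\<in>{i, j}. \<bar>v a b $ k\<bar>)"
      by (rule sum.mono_neutral_right) (auto simp: v_def axis_def)
    then show ?thesis using ij by (simp add: cross_polytope_def v_def axis_def)
  qed
  define P U where "P = v p\<^sub>1 p\<^sub>2" and "U = v u\<^sub>1 u\<^sub>2"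
  define L where "L = range (\<lambda>s. P + s *\<^sub>R U)"
  have U: "norm U = 1"
    using nrm[of u\<^sub>1 u\<^sub>2] u power2_eq_iff_nonneg[of "norm U" 1] by (simp add: U_def)
  have "(norm P)\<^sup>2 - (P \<bullet> U)\<^sup>2 = t\<^sup>2"
    unfolding P_def U_def nrm inner det[symmetric] using u by algebra
  then have "infdist 0 L = t"
    unfolding L_def infdist_line[OF U] using \<open>0 \<le> t\<close> by simp
  then have "L \<in> lines_at_distance t"
    using U is_line_parametrization[of L] by (auto simp: lines_at_distance_def L_def)
  moreover have "L \<subseteq> span {axis i 1, axis j 1}"
    unfolding L_def P_def U_def add unfolding v_def
    by (intro image_subsetI span_add span_scale span_base) auto
  moreover have "l \<le> length_on L (cross_polytope :: (real ^ 'n) set)"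
  proof -
    obtain a b where ab: "{s. P + s *\<^sub>R U \<in> cross_polytope} = {a..b}"
      using chord_parameters_interval[OF U] by blast
    have "0 \<in> {a..b}" "l \<in> {a..b}"
      unfolding ab[symmetric] P_def U_def add mem mem_Collect_eq using p q by simp_all
    then show ?thesis
      unfolding length_on_eq[OF U L_def] ab by simp
  qed
  ultimately show ?thesis by blast
qed

lemma planar_chord_max_length:
  fixes i j :: "'n::finite"
  assumes ij: "i \<noteq> j" and t: "0 \<le> t" "t \<le> 1"
  shows "\<exists>L \<in> lines_at_distance t. L \<subseteq> span {axis i 1, axis j 1} \<and>
    max_chord_length t \<le> length_on L (cross_polytope :: (real ^ 'n) set)"
proof (cases "2 * t\<^sup>2 \<le> 1")
  case True
  define c where "c = sqrt (1 - t\<^sup>2)"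
  have c: "0 \<le> c" "t\<^sup>2 + c\<^sup>2 = 1" using t True by (simp_all add: c_def)
  have "t \<le> c" using t c True by (intro power2_le_imp_le[of t c]) linarith+
  have tc: "0 < t + c" using t c by (smt (verit) power_zero_numeral)
  define l where "l = 2 / (t + c)"
  have "l * (t + c) = 2" using tc unfolding l_def by (metis less_irrefl nonzero_divide_eq_eq)
  moreover have "0 \<le> l" using tc by (simp add: l_def)
  moreover have "l * t \<le> l * c" using \<open>t \<le> c\<close> \<open>0 \<le> l\<close> by (intro mult_left_mono)
  moreover have "0 \<le> l * t" using t \<open>0 \<le> l\<close> by simp
  ultimately have "\<bar>1 + l * - c\<bar> + \<bar>0 + l * t\<bar> \<le> 1" by (simp add: algebra_simps)
  \<comment> \<open>The chord runs from \<open>e\<^sub>i\<close> in direction \<open>(-c, t)\<close> to the edge between \<open>- e\<^sub>i\<close> and \<open>e\<^sub>j\<close>.\<close>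
  then have "\<exists>L \<in> lines_at_distance t. L \<subseteq> span {axis i 1, axis j 1} \<and>
      l \<le> length_on L (cross_polytope :: (real ^ 'n) set)"
    using c t \<open>0 \<le> l\<close> by (intro planar_chord[OF ij, of "- c" t 1 0]) auto
  then show ?thesis
    using max_chord_length_small[OF True t(1)] by (simp add: l_def c_def)
next
  case False
  show ?thesis
  proof (cases "t \<le> 3 / 4")
    case True
    define w where "w = sqrt (t\<^sup>2 - 1 / 2)"
    have w: "0 \<le> w" "w\<^sup>2 = t\<^sup>2 - 1 / 2" using False by (simp_all add: w_def)
    define l where "l = t - w"
    have tl: "t * l = 1 / 4 + l\<^sup>2 / 2"
      unfolding l_def using w by (simp add: power2_eq_square field_simps)
    have "w\<^sup>2 \<le> (1 / 4)\<^sup>2" using power_mono[OF True t(1), of 2] unfolding w by (simp add: power_divide)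
    then have "w \<le> 1 / 4" by (rule power2_le_imp_le) simp
    have "1 = 2 * (l * (t + w))" using w by (simp add: l_def power2_eq_square algebra_simps)
    have "w \<le> t" using w t by (intro power2_le_imp_le[of w t]) linarith+
    then have "0 \<le> l" by (simp add: l_def)
    have "l * (t + w) \<le> l * 1"
      using \<open>0 \<le> l\<close> \<open>w \<le> 1 / 4\<close> True by (intro mult_left_mono) auto
    moreover have "l * l \<le> l * (t + w)"
      using \<open>0 \<le> l\<close> w by (intro mult_left_mono) (auto simp: l_def)
    ultimately have l: "0 < l" "1 / 2 \<le> l" and l2: "l\<^sup>2 \<le> 1 / 2"
      using \<open>1 = 2 * (l * (t + w))\<close> unfolding power2_eq_square by linarith+
    \<comment> \<open>The endpoints are \<open>(1 - a, a)\<close> and \<open>(1 - b, - b)\<close> with \<open>a + b = 1 / 2\<close> and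
        \<open>2 * (a\<^sup>2 + b\<^sup>2) = l\<^sup>2\<close>, the equality case of \<open>corner_bound\<close>; \<open>D\<close> is \<open>a - b\<close>.\<close>
    define D where "D = sqrt (l\<^sup>2 - 1 / 4)"
    have D: "0 \<le> D" "D\<^sup>2 = l\<^sup>2 - 1 / 4"
      using power_mono[OF l(2), of 2] by (simp_all add: D_def power2_eq_square)
    have "D\<^sup>2 \<le> (1 / 2)\<^sup>2" unfolding D(2) using l2 by (simp add: power_divide)
    then have D2: "D \<le> 1 / 2" by (rule power2_le_imp_le) simp
    define b where "b = 1 / 4 - D / 2"
    have "(1 - b) * (1 / (2 * l)) - (- b) * (- D / l) = ((1 - b) / 2 - b * D) / l"
      using l by (simp add: field_simps)
    also have "(1 - b) / 2 - b * D = t * l"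
      unfolding tl b_def using D by (simp add: power2_eq_square field_simps)
    also have "t * l / l = t" using l by simp
    finally have det: "(1 - b) * (1 / (2 * l)) - (- b) * (- D / l) = t" .
    have "\<exists>L \<in> lines_at_distance t. L \<subseteq> span {axis i 1, axis j 1} \<and>
        l \<le> length_on L (cross_polytope :: (real ^ 'n) set)"
    proof (rule planar_chord[OF ij _ det])
      show "(- D / l)\<^sup>2 + (1 / (2 * l))\<^sup>2 = 1"
        using D l by (simp add: power_divide field_simps)
    qed (use t l D D2 in \<open>auto simp: b_def\<close>)
    then show ?thesis
      using max_chord_length_large[of t] t True False by (simp add: l_def w_def)
  next
    case far: False
    have "\<exists>L \<in> lines_at_distance t. L \<subseteq> span {axis i 1, axis j 1} \<and>
        2 - 2 * t \<le> length_on L (cross_polytope :: (real ^ 'n) set)"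
      using t by (intro planar_chord[OF ij, of 0 1 t "t - 1"]) auto
    then show ?thesis
      using max_chord_length_large[of t] t far False by simp
  qed
qed

section \<open>The maximal chord length\<close>

theorem theorem1:
  fixes t :: real
  assumes "CARD('n::finite) \<ge> 2" and "0 \<le> t" and "t \<le> 1"
  shows "(\<exists>L \<in> lines_at_distance t.
            length_on L (cross_polytope :: (real ^ 'n) set) = max_chord_length t) \<and>
         (\<forall>L \<in> lines_at_distance t.
            length_on L (cross_polytope :: (real ^ 'n) set) \<le> max_chord_length t) \<and>
         (\<exists>L \<in> lines_at_distance t.
            (\<exists>i j :: 'n. i \<noteq> j \<and> L \<subseteq> span {axis i 1, axis j 1}) \<and>
            length_on L (cross_polytope :: (real ^ 'n) set) = max_chord_length t)"
proof -
  obtain i j :: 'n where ij: "i \<noteq> j"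
    using assms(1) card_le_Suc0_iff_eq[of "UNIV :: 'n set"] by force
  have upper: "length_on L (cross_polytope :: (real ^ 'n) set) \<le> max_chord_length t"
    if "L \<in> lines_at_distance t" for L
    using length_on_le_max_chord_length[OF that assms(2,3)] .
  obtain L :: "(real ^ 'n) set" where "L \<in> lines_at_distance t"
    and "L \<subseteq> span {axis i 1, axis j 1}" and "max_chord_length t \<le> length_on L cross_polytope"
    using planar_chord_max_length[OF ij assms(2,3)] by blast
  moreover from this have "length_on L cross_polytope = max_chord_length t"
    using upper by (intro antisym)
  ultimately show ?thesis using upper ij by blast
qed

end
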